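(* Let $n\ge 1$ and $N\ge 1$ be integers, let $p_1,\dots,p_n>0$ be real numbers with $\sum_{i=1}^n p_i=1$, and let $m=(m_1,\dots,m_n)\in\mathbb Z_{\ge0}^n$ satisfy $\sum_{i=1}^n m_i=N$. The following are equivalent. (a) $m$ maximises $P(m')=\dfrac{N!}{m'_1!\cdots m'_n!}\prod_{i=1}^n p_i^{m'_i}$ over all $m'\in\mathbb Z_{\ge0}^n$ with $\sum_i m'_i=N$. (b) $\dfrac{m_j}{p_j}\le\dfrac{m_i+1}{p_i}$ for all $i,j\in\{1,\dots,n\}$; equivalently $\max_j \dfrac{m_j}{p_j}\le\min_i\dfrac{m_i+1}{p_i}$. (c) There is a real number $\lambda>0$ with $m_i\le\lambda p_i\le m_i+1$ for all $1\le i\le n$. (d) $m_i$ is the number of the $N$ largest members of the multiset $\{p_i/k: 1\le i\le n,\ k\ge1\}$ that lie in bin $i$, ties at the boundary value being resolved in some way consistent with $\sum_i m_i=N$. That is, there is a set $A\subset\{1,\dots,n\}\times\mathbb Z_{\ge1}$ with $|A|=N$ such that $p_i/k\ge p_j/\ell$ whenever $(i,k)\in A$ and $(j,\ell)\notin A$, and $m_i=|\{k:(i,k)\in A\}|$ for every $i$. Moreover, when these conditions hold, the set of $\lambda$ admissible in (c) is exactly the closed interval $\bigl[\max_j m_j/p_j,\ \min_i (m_i+1)/p_i\bigr]$, and every admissible $\lambda$ satisfies $\lambda\in[N,N+n]$.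
   Context: $P(m)$ is the probability $\Pr\{X=m\}$ for $X$ multinomially distributed with parameters $N$ and $(p_1,\dots,p_n)$. A maximiser of $P$ is called a mode. The multiset $\{p_i/k\}$ is indexed by the pairs $(i,k)$, and the member indexed by $(i,k)$ is said to lie in bin $i$. *)

theory Defs
  imports Complex_Main
begin

text \<open>
  A vector with entries indexed by \<open>{1..n}\<close> is represented by a function on \<open>nat\<close>; its values
  outside \<open>{1..n}\<close> are unconstrained and play no role.
\<close>

definition compositions :: "nat \<Rightarrow> nat \<Rightarrow> (nat \<Rightarrow> nat) set" where
  "compositions n N = {m. (\<Sum>i=1..n. m i) = N}"

text \<open>The division is in \<open>real\<close>, so no divisibility of factorials is needed.\<close>

definition multinomial_prob :: "nat \<Rightarrow> nat \<Rightarrow> (nat \<Rightarrow> real) \<Rightarrow> (nat \<Rightarrow> nat) \<Rightarrow> real" where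
  "multinomial_prob n N p m = fact N / (\<Prod>i=1..n. fact (m i)) * (\<Prod>i=1..n. p i ^ m i)"

definition multinomial_mode :: "nat \<Rightarrow> nat \<Rightarrow> (nat \<Rightarrow> real) \<Rightarrow> (nat \<Rightarrow> nat) \<Rightarrow> bool" where
  "multinomial_mode n N p m \<longleftrightarrow>
     is_arg_max (multinomial_prob n N p) (\<lambda>m'. m' \<in> compositions n N) m"

text \<open>
  \<open>A\<close> is a choice of \<open>N\<close> largest members of the multiset of all \<open>p i / k\<close> with \<open>i \<in> {1..n}\<close> and
  \<open>k \<ge> 1\<close>, where the member \<open>p i / k\<close> is identified by its index \<open>(i, k)\<close>. At the boundary value
  there may be several such \<open>A\<close>, one for each way of resolving ties.
\<close>

definition largest_members :: "nat \<Rightarrow> nat \<Rightarrow> (nat \<Rightarrow> real) \<Rightarrow> (nat \<times> nat) set \<Rightarrow> bool" where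
  "largest_members n N p A \<longleftrightarrow>
     A \<subseteq> {1..n} \<times> {1..} \<and> finite A \<and> card A = N \<and>
     (\<forall>(i, k) \<in> A. \<forall>(j, l) \<in> {1..n} \<times> {1..} - A. p i / real k \<ge> p j / real l)"

end

theory Submission
  imports Defs
begin

text \<open>
  Multiplying the terms \<open>(x * p i) ^ m i / fact (m i)\<close> over \<open>i\<close> gives the multinomial probability
  up to the constant factor \<open>x ^ N / fact N\<close>. If \<open>m i \<le> x * p i \<le> m i + 1\<close>, each factor is
  at its maximum, as for a Poisson distribution with mean \<open>x * p i\<close>; hence (c) implies (a). Moving
  one unit from bin \<open>j\<close> to bin \<open>i\<close> multiplies the probability by \<open>(p i / (m i + 1)) / (p j / m j)\<close>,
  so (a) implies (b). Any number between the largest \<open>m j / p j\<close> and the smallest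
  \<open>(m i + 1) / p i\<close> serves as \<open>x\<close> in (c). Finally (b) says that the last member taken from any bin
  is at least the first member not taken from any other bin, which is (d).
\<close>

text \<open>The weight at \<open>Suc k\<close> is the weight at \<open>k\<close> times
  \<open>t / Suc k\<close>. This factor is at most 1 for \<open>k \<ge> m\<close>, because
  \<open>t \<le> m + 1\<close>, and at least 1 for \<open>k < m\<close>, because
  \<open>m \<le> t\<close>. So the weights decrease away from \<open>m\<close> in both
  directions.\<close>

lemma poisson_weight_le_mode:
  fixes t :: real and m k :: nat
  assumes "real m \<le> t" and "t \<le> real m + 1"
  shows "t ^ k / fact k \<le> t ^ m / fact m"
proof (cases "m \<le> k")
  case True
  then show ?thesis
  proof (induction k rule: dec_induct)
    case base
    show ?case by simp
  next
    case (step k)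
    have "t ^ Suc k / fact (Suc k) = t ^ k / fact k * (t / real (Suc k))"
      by (simp add: field_simps)
    also have "\<dots> \<le> t ^ k / fact k"
      using assms step.hyps by (intro mult_right_le_one_le) auto
    finally show ?case using step.IH by linarith
  qed
next
  case False
  then have "k \<le> m" by simp
  then show ?thesis
  proof (induction k rule: inc_induct)
    case base
    show ?case by simp
  next
    case (step k)
    have "t ^ k / fact k \<le> t ^ k / fact k * (t / real (Suc k))"
    proof -
      have "t ^ k / fact k * 1 \<le> t ^ k / fact k * (t / real (Suc k))"
        using assms step.hyps by (intro mult_left_mono) auto
      then show ?thesis by simp
    qed
    also have "\<dots> = t ^ Suc k / fact (Suc k)"
      by (simp add: field_simps)
    finally show ?case using step.IH by linarith
  qed
qed

lemma multinomial_prob_eq_prod: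
  "multinomial_prob n N p m = fact N * (\<Prod>i=1..n. p i ^ m i / fact (m i))"
  by (simp add: multinomial_prob_def prod_dividef)

text \<open>The exponents sum to \<open>N\<close>, so \<open>x ^ N\<close> splits into one factor
  \<open>x ^ m i\<close> per bin. As \<open>x ^ N\<close> is the same for all compositions,
  probabilities can be compared bin by bin.\<close>

lemma multinomial_prob_scale:
  assumes "m \<in> compositions n N"
  shows "x ^ N * multinomial_prob n N p m = fact N * (\<Prod>i=1..n. (x * p i) ^ m i / fact (m i))"
proof -
  have "x ^ N = (\<Prod>i=1..n. x ^ m i)"
    using assms by (simp add: compositions_def flip: power_sum)
  then show ?thesis
    by (simp add: multinomial_prob_eq_prod power_mult_distrib prod_dividef prod.distrib)
qed

lemma multinomial_mode_iff:
  "multinomial_mode n N p m \<longleftrightarrow> m \<in> compositions n N \<and>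
     (\<forall>m'\<in>compositions n N. multinomial_prob n N p m' \<le> multinomial_prob n N p m)"
  by (auto simp: multinomial_mode_def is_arg_max_linorder)

lemma multinomial_modeI:
  assumes "m \<in> compositions n N" and "x > 0"
    and bounds: "\<And>i. i \<in> {1..n} \<Longrightarrow> real (m i) \<le> x * p i \<and> x * p i \<le> real (m i) + 1"
  shows "multinomial_mode n N p m"
  unfolding multinomial_mode_iff
proof (intro conjI ballI)
  fix m' assume m': "m' \<in> compositions n N"
  have "(\<Prod>i=1..n. (x * p i) ^ m' i / fact (m' i)) \<le> (\<Prod>i=1..n. (x * p i) ^ m i / fact (m i))"
  proof (rule prod_mono)
    fix i assume "i \<in> {1..n}"
    then have "real (m i) \<le> x * p i" "x * p i \<le> real (m i) + 1"
      using bounds by auto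
    \<comment> \<open>\<open>prod_mono\<close> needs nonnegative factors; the sign of
      \<open>x * p i\<close> comes from the lower bound \<open>m i\<close>.\<close>
    moreover from this have "0 \<le> x * p i"
      using of_nat_0_le_iff order_trans by blast
    ultimately show "0 \<le> (x * p i) ^ m' i / fact (m' i) \<and>
        (x * p i) ^ m' i / fact (m' i) \<le> (x * p i) ^ m i / fact (m i)"
      using poisson_weight_le_mode by simp
  qed
  then have "x ^ N * multinomial_prob n N p m' \<le> x ^ N * multinomial_prob n N p m"
    using assms(1) m' by (simp add: multinomial_prob_scale)
  then show "multinomial_prob n N p m' \<le> multinomial_prob n N p m"
    using \<open>x > 0\<close> by simp
qed (fact assms(1))

lemma multinomial_mode_ratio_le:
  assumes mode: "multinomial_mode n N p m"
    and pos: "\<And>i. i \<in> {1..n} \<Longrightarrow> p i > 0"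
    and i: "i \<in> {1..n}" and j: "j \<in> {1..n}"
  shows "real (m j) / p j \<le> (real (m i) + 1) / p i"
\<comment> \<open>Both special cases are immediate; otherwise bin \<open>j\<close> has a unit to
  give to a different bin \<open>i\<close>.\<close>
proof (cases "i = j \<or> m j = 0")
  case True
  then show ?thesis using pos[OF i] by (auto simp: divide_right_mono)
next
  case False
  then obtain k where ne: "i \<noteq> j" and k: "m j = Suc k"
    by (cases "m j") auto
  define m' where "m' = m(i := Suc (m i), j := k)"
  define R where "R = {1..n} - {i, j}"
  have split: "{1..n} = insert i (insert j R)" and R: "finite R" "i \<notin> R" "j \<notin> R"
    using i j by (auto simp: R_def)
  have sum_eq: "sum m' {1..n} = sum m {1..n}"
  proof -
    have "sum m' R = sum m R"
      unfolding m'_def using R by (intro sum.cong) auto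
    then show ?thesis
      unfolding split using R ne k by (simp add: m'_def)
  qed
  define Q where "Q = (\<Prod>l\<in>R. p l ^ m l / fact (m l))"
  have "Q > 0"
    unfolding Q_def using pos by (intro prod_pos) (auto simp: R_def)
  have pi: "p i > 0" and pj: "p j > 0" using pos i j by auto
  \<comment> \<open>\<open>W\<close> is the product for \<open>m\<close> with one unit removed from
    bin \<open>j\<close>. Putting the unit into bin \<open>i\<close> gives \<open>m'\<close>, and
    putting it back into bin \<open>j\<close> gives \<open>m\<close>, so the two probabilities
    differ only in the last factor.\<close>
  define W where "W = p i ^ m i / fact (m i) * (p j ^ k / fact k) * Q"
  have "W > 0" using pi pj \<open>Q > 0\<close> by (simp add: W_def)
  have "(\<Prod>l\<in>R. p l ^ m' l / fact (m' l)) = Q"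
    unfolding Q_def m'_def using R by (intro prod.cong) auto
  then have "multinomial_prob n N p m' = fact N * (W * (p i / (real (m i) + 1)))"
    unfolding multinomial_prob_eq_prod split
    using R ne by (simp add: m'_def W_def field_simps)
  moreover have "multinomial_prob n N p m = fact N * (W * (p j / real (m j)))"
    unfolding multinomial_prob_eq_prod split
    using R ne k by (simp add: W_def Q_def field_simps)
  moreover have "m' \<in> compositions n N"
    using mode sum_eq by (simp add: multinomial_mode_iff compositions_def)
  ultimately have "fact N * (W * (p i / (real (m i) + 1))) \<le> fact N * (W * (p j / real (m j)))"
    using mode unfolding multinomial_mode_iff by metis
  then have "p i / (real (m i) + 1) \<le> p j / real (m j)"
    using \<open>W > 0\<close> by (simp only: mult_le_cancel_left_pos fact_gt_zero)
  then show ?thesis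
    using pi pj k by (simp add: field_simps)
qed

text \<open>Within a bin \<open>p i / k\<close> decreases in \<open>k\<close>, so the first
  \<open>m i\<close> members are its largest. It remains to compare the last member taken from one
  bin with the first one left in another.\<close>

lemma largest_members_of_ratio_le:
  assumes m: "m \<in> compositions n N"
    and pos: "\<And>i. i \<in> {1..n} \<Longrightarrow> p i > 0"
    and le: "\<And>i j. i \<in> {1..n} \<Longrightarrow> j \<in> {1..n} \<Longrightarrow> real (m j) / p j \<le> (real (m i) + 1) / p i"
  shows "largest_members n N p (SIGMA i:{1..n}. {1..m i})"
  unfolding largest_members_def
proof (intro conjI ballI, goal_cases)
  case 3
  show ?case using m by (simp add: compositions_def)
next
  case (4 a)
  then obtain i k where a: "a = (i, k)" and i: "i \<in> {1..n}" and k: "1 \<le> k" "k \<le> m i"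
    by auto
  have "p j / real l \<le> p i / real k"
    if j: "j \<in> {1..n}" and l: "1 \<le> l" "(j, l) \<notin> (SIGMA i:{1..n}. {1..m i})" for j l
  proof -
    have "m j + 1 \<le> l" using j l by auto
    then have "p j / real l \<le> p j / (real (m j) + 1)"
      using pos[OF j] by (intro divide_left_mono) auto
    \<comment> \<open>This is the hypothesis with the bins exchanged, after taking reciprocals;
      \<open>m i\<close> is nonzero because \<open>1 \<le> k \<le> m i\<close>.\<close>
    also have "\<dots> \<le> p i / real (m i)"
      using le[OF j i] pos[OF i] pos[OF j] k by (simp add: field_simps)
    also have "\<dots> \<le> p i / real k"
      using pos[OF i] k by (intro divide_left_mono) auto
    finally show ?thesis .
  qed
  then show ?case using a by fastforce
qed auto

text \<open>Pigeonhole gives a member of \<open>A\<close> in bin \<open>j\<close> with index at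
  least \<open>m j\<close> and a member outside \<open>A\<close> in bin \<open>i\<close> with index
  at most \<open>m i + 1\<close>. Comparing these two avoids showing that \<open>A\<close> takes an
  initial segment of each bin.\<close>

lemma ratio_le_of_largest_members:
  assumes A: "largest_members n N p A"
    and card: "\<And>i. i \<in> {1..n} \<Longrightarrow> m i = card {k. (i, k) \<in> A}"
    and pos: "\<And>i. i \<in> {1..n} \<Longrightarrow> p i > 0"
    and i: "i \<in> {1..n}" and j: "j \<in> {1..n}"
  shows "real (m j) / p j \<le> (real (m i) + 1) / p i"
proof (cases "m j = 0")
  case True
  then show ?thesis using pos[OF i] by simp
next
  case False
  have sub: "A \<subseteq> {1..n} \<times> {1..}"
    using A by (simp add: largest_members_def)
  have largest: "p j / real l \<le> p i / real k"
      if "(i, k) \<in> A" "(j, l) \<in> {1..n} \<times> {1..} - A" for i k j l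
    using A that unfolding largest_members_def by fast
  have fin: "finite {k. (i, k) \<in> A}" for i
    using A finite_Image[of A "{i}"] by (simp add: largest_members_def Image_singleton)
  obtain k where k: "(j, k) \<in> A" "m j \<le> k"
  proof -
    \<comment> \<open>The interval has only \<open>m j - 1\<close> elements, as \<open>m j\<close>
      is nonzero.\<close>
    have "\<not> {k. (j, k) \<in> A} \<subseteq> {1..<m j}"
      using card_mono[of "{1..<m j}" "{k. (j, k) \<in> A}"] card[OF j] False by auto
    then obtain k where "(j, k) \<in> A" "k \<notin> {1..<m j}" by blast
    moreover from this have "1 \<le> k" using sub by auto
    ultimately show thesis using that by auto
  qed
  obtain l where l: "(i, l) \<notin> A" "1 \<le> l" "l \<le> m i + 1"
  proof -
    have "\<not> {1..m i + 1} \<subseteq> {k. (i, k) \<in> A}"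
      using card_mono[OF fin, of "{1..m i + 1}" i] card[OF i] by auto
    then obtain l where "l \<in> {1..m i + 1}" "(i, l) \<notin> A" by blast
    then show thesis using that by simp
  qed
  have "p i / (real (m i) + 1) \<le> p i / real l"
    using pos[OF i] l by (intro divide_left_mono) auto
  also have "\<dots> \<le> p j / real k"
    using largest k l i by simp
  also have "\<dots> \<le> p j / real (m j)"
    using pos[OF j] k False by (intro divide_left_mono) auto
  finally show ?thesis
    using pos[OF i] pos[OF j] False by (simp add: field_simps)
qed

theorem theorem3p1:
  fixes n N :: nat and p :: "nat \<Rightarrow> real" and m :: "nat \<Rightarrow> nat"
  assumes "n \<ge> 1" and "N \<ge> 1"
    and "\<forall>i\<in>{1..n}. p i > 0" and "(\<Sum>i=1..n. p i) = 1"
    and "m \<in> compositions n N"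
  shows
    "(multinomial_mode n N p m \<longleftrightarrow>
        (\<forall>i\<in>{1..n}. \<forall>j\<in>{1..n}. real (m j) / p j \<le> (real (m i) + 1) / p i)) \<and>
     ((\<forall>i\<in>{1..n}. \<forall>j\<in>{1..n}. real (m j) / p j \<le> (real (m i) + 1) / p i) \<longleftrightarrow>
        (MAX j\<in>{1..n}. real (m j) / p j) \<le> (MIN i\<in>{1..n}. (real (m i) + 1) / p i)) \<and>
     (multinomial_mode n N p m \<longleftrightarrow>
        (\<exists>x>0. \<forall>i\<in>{1..n}. real (m i) \<le> x * p i \<and> x * p i \<le> real (m i) + 1)) \<and>
     (multinomial_mode n N p m \<longleftrightarrow>
        (\<exists>A. largest_members n N p A \<and> (\<forall>i\<in>{1..n}. m i = card {k. (i, k) \<in> A}))) \<and>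
     (multinomial_mode n N p m \<longrightarrow>
        {x. x > 0 \<and> (\<forall>i\<in>{1..n}. real (m i) \<le> x * p i \<and> x * p i \<le> real (m i) + 1)} =
          {(MAX j\<in>{1..n}. real (m j) / p j) .. (MIN i\<in>{1..n}. (real (m i) + 1) / p i)} \<and>
        (\<forall>x>0. (\<forall>i\<in>{1..n}. real (m i) \<le> x * p i \<and> x * p i \<le> real (m i) + 1) \<longrightarrow>
          x \<in> {real N .. real N + real n}))"
proof -
  let ?I = "{1..n}"
  let ?b = "\<forall>i\<in>?I. \<forall>j\<in>?I. real (m j) / p j \<le> (real (m i) + 1) / p i"
  let ?M = "MAX j\<in>?I. real (m j) / p j"
  let ?L = "MIN i\<in>?I. (real (m i) + 1) / p i"
  let ?adm = "\<lambda>x. \<forall>i\<in>?I. real (m i) \<le> x * p i \<and> x * p i \<le> real (m i) + 1"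
  let ?d = "\<exists>A. largest_members n N p A \<and> (\<forall>i\<in>?I. m i = card {k. (i, k) \<in> A})"
  have pos: "\<And>i. i \<in> ?I \<Longrightarrow> p i > 0" and ne: "?I \<noteq> {}"
    using assms by auto
  have sum_m: "(\<Sum>i=1..n. m i) = N"
    using assms(5) by (simp add: compositions_def)
  have b_iff: "?b \<longleftrightarrow> ?M \<le> ?L"
    using ne by auto
  have adm_iff: "?adm x \<longleftrightarrow> ?M \<le> x \<and> x \<le> ?L" for x
    using ne pos by (auto simp: pos_divide_le_eq pos_le_divide_eq)
  \<comment> \<open>Some entry is nonzero because \<open>N \<ge> 1\<close>. Hence \<open>?M\<close>
    itself is a positive witness for (c), and every point of the closed interval is
    positive.\<close>
  have "?M > 0"
  proof -
    obtain j where j: "j \<in> ?I" "m j \<noteq> 0"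
      using sum_m assms(2) by (metis not_one_le_zero sum.neutral)
    then have "0 < real (m j) / p j" using pos by simp
    also have "\<dots> \<le> ?M" using j by (intro Max_ge) auto
    finally show ?thesis .
  qed
  have a_b: ?b if "multinomial_mode n N p m"
    using multinomial_mode_ratio_le[OF that pos] by blast
  have b_c: "\<exists>x>0. ?adm x" if ?b
    using that \<open>?M > 0\<close> unfolding b_iff adm_iff by blast
  have c_a: "multinomial_mode n N p m" if "\<exists>x>0. ?adm x"
    using that multinomial_modeI[OF assms(5)] by blast
  have b_d: ?d if ?b
  proof (intro exI conjI ballI)
    show "largest_members n N p (SIGMA i:?I. {1..m i})"
      using that by (intro largest_members_of_ratio_le[OF assms(5) pos]) auto
    show "m i = card {k. (i, k) \<in> (SIGMA i:?I. {1..m i})}" if "i \<in> ?I" for i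
    proof -
      have "{k. (i, k) \<in> (SIGMA i:?I. {1..m i})} = {1..m i}"
        using that by auto
      then show ?thesis by simp
    qed
  qed
  have d_b: ?b if ?d
    using that ratio_le_of_largest_members[where p = p and m = m and n = n and N = N] pos by blast
  have set_eq: "{x. x > 0 \<and> ?adm x} = {?M .. ?L}"
    unfolding adm_iff using \<open>?M > 0\<close> by auto
  \<comment> \<open>Summing the bounds over all bins turns \<open>x * p i\<close> into
    \<open>x\<close>, since the \<open>p i\<close> sum to 1, and the outer terms into
    \<open>N\<close> and \<open>N + n\<close>.\<close>
  have range: "x \<in> {real N .. real N + real n}" if "?adm x" for x
  proof -
    have eq: "(\<Sum>i=1..n. x * p i) = x"
      using assms(4) by (simp flip: sum_distrib_left)
    have "(\<Sum>i=1..n. real (m i)) \<le> (\<Sum>i=1..n. x * p i)"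
      using that by (intro sum_mono) auto
    moreover have "(\<Sum>i=1..n. x * p i) \<le> (\<Sum>i=1..n. real (m i) + 1)"
      using that by (intro sum_mono) auto
    ultimately show ?thesis
      using sum_m unfolding eq by (simp add: sum.distrib flip: of_nat_sum)
  qed
  have ab: "multinomial_mode n N p m \<longleftrightarrow> ?b"
    using a_b b_c c_a by blast
  have ac: "multinomial_mode n N p m \<longleftrightarrow> (\<exists>x>0. ?adm x)"
    using a_b b_c c_a by blast
  have ad: "multinomial_mode n N p m \<longleftrightarrow> ?d"
    using ab b_d d_b by blast
  show ?thesis
    using ab b_iff ac ad set_eq range by (intro conjI impI allI) blast+
qed

end
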